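(* Let $\mathcal{D}=\{X\in\mathcal{S}_+^n:\ \operatorname{rank}(X)\le k,\ f(\lambda(X))\le 0\}$ and let $\tilde k\le k$ be its strengthened rank. Suppose that $F^d\subseteq\operatorname{conv}(\mathcal{D})$ is a $d$-dimensional face of $\operatorname{conv}(\mathcal{D})$. Then every point of $F^d$ has rank at most $\tilde k+\lfloor\sqrt{2d+9/4}-3/2\rfloor$.
   Context: $k\le n$ are positive integers; $\mathcal{S}_+^n$ is the set of $n\times n$ real symmetric positive semidefinite matrices; $\operatorname{conv}$ denotes convex hull. $\lambda(X)\in\mathbb{R}^n$ is the vector of eigenvalues of $X$. The function $f:\mathbb{R}^n\to\mathbb{R}$ is continuous, convex and symmetric (invariant under permutations of its arguments), so that $X\mapsto f(\lambda(X))$ is a continuous convex spectral function. Strengthened rank: $\tilde k$ with $1\le\tilde k\le k$ is the smallest integer such that $\operatorname{conv}(\mathcal{D})=\operatorname{conv}(\{X\in\mathcal{S}_+^n:\ \operatorname{rank}(X)\le\tilde k,\ f(\lambda(X))\le0\})$. A convex subset $F$ of a closed convex set $T$ is a face of $T$ if for every line segment $[a,b]\subseteq T$ with $F\cap(a,b)\ne\emptyset$ one has $[a,b]\subseteq F$. The dimension of a face is the dimension of its affine hull. *)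

theory Defs
  imports "HOL-Analysis.Analysis"
begin

definition psd :: "(real ^ 'n ^ 'n) set" where
  "psd = {X. transpose X = X \<and> (\<forall>x. 0 \<le> x \<bullet> (X *v x))}"

text \<open>
  The index type of a vector carries no order, so the eigenvalues of \<open>X\<close>, repeated according to
  their multiplicity as roots of the characteristic polynomial, are listed in an arbitrary order.
  Such a listing exists for every symmetric \<open>X\<close> and is unique up to a permutation of the entries,
  hence \<open>f (eigvals X)\<close> does not depend on the choice when \<open>f\<close> is symmetric.
\<close>

definition eigvals :: "real ^ 'n ^ 'n \<Rightarrow> real ^ 'n" where
  "eigvals X = (SOME v. \<forall>t. det (mat t - X) = (\<Prod>i\<in>UNIV. (t - v $ i)))"

definition symmetric_fun :: "(real ^ 'n \<Rightarrow> real) \<Rightarrow> bool" where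
  "symmetric_fun f \<longleftrightarrow> (\<forall>p x. p permutes UNIV \<longrightarrow> f (\<chi> i. x $ p i) = f x)"

definition rank_spectral_set :: "(real ^ 'n \<Rightarrow> real) \<Rightarrow> nat \<Rightarrow> (real ^ 'n ^ 'n) set" where
  "rank_spectral_set f k = {X \<in> psd. rank X \<le> k \<and> f (eigvals X) \<le> 0}"

definition strengthened_rank :: "(real ^ 'n \<Rightarrow> real) \<Rightarrow> nat \<Rightarrow> nat" where
  "strengthened_rank f k =
     (LEAST j. 1 \<le> j \<and> j \<le> k \<and>
        convex hull (rank_spectral_set f k) = convex hull (rank_spectral_set f j))"

end

theory Submission
  imports Defs "HOL-Computational_Algebra.Polynomial" "HOL-Combinatorics.Permutations"
begin

text \<open>
  Replacing \<open>k\<close> by the strengthened rank does not change the convex hull, so it suffices to bound the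
  excess \<open>s\<close> in \<open>rank X = k + s\<close> for a point \<open>X\<close> of a \<open>d\<close>-dimensional face of the hull \<open>K\<close> of the
  admissible matrices of rank at most \<open>k\<close>. The claimed bound is the inequality
  \<open>s * (s + 3) \<le> 2 * d\<close> solved for \<open>s\<close>, and \<open>s * (s + 3) div 2\<close> is the dimension of the space of
  traceless symmetric matrices of order \<open>s + 1\<close>. The reason for it is that, if \<open>s > 0\<close>, then \<open>X\<close>
  can be moved inside \<open>K\<close>, forwards and backwards, along every traceless symmetric matrix supported
  on the eigenvectors of the \<open>s + 1\<close> smallest positive eigenvalues of \<open>X\<close>; a face through \<open>X\<close> is
  parallel to all such directions (\<open>dim_two_sided_directions_le_face\<close>).

  To see that these motions stay in \<open>K\<close>, the problem is reduced to vectors. A symmetric matrix lies in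
  \<open>K\<close> iff its spectrum lies in the hull \<open>C\<close> of the admissible spectra with at most \<open>k\<close> nonzero
  entries (\<open>spectral_matrix_in_hull_iff\<close>). From spectra to matrices this is linearity. Conversely, the
  diagonal of a matrix in any orthonormal basis is a doubly stochastic image of its spectrum,
  and such an image is a convex combination of rearrangements (\<open>doubly_stochastic_image_in_hull\<close>).

  In \<open>C\<close> the decisive move is to push two of the \<open>s + 1\<close> small eigenvalues apart
  (\<open>spread_two_small_entries\<close>). Together with the \<open>k - 1\<close> larger ones they occupy \<open>k + 1\<close> positions, so
  each admissible spectrum in a convex combination for the spectrum of \<open>X\<close> has a zero among them,
  and swapping this zero with a positive entry creates the required room. This gives the
  diagonal directions. The off-diagonal ones follow by using the perturbed spectra in a rotated
  eigenbasis (\<open>two_sided_block_directions\<close>).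
\<close>

section \<open>Matrices with prescribed spectral decomposition\<close>

definition orthonormal :: "('n \<Rightarrow> real ^ 'n) \<Rightarrow> bool" where
  "orthonormal q \<longleftrightarrow> (\<forall>i j. q i \<bullet> q j = (if i = j then 1 else 0))"

definition outer :: "real ^ 'n \<Rightarrow> real ^ 'n \<Rightarrow> real ^ 'n ^ 'n" where
  "outer u w = (\<chi> r c. u $ r * w $ c)"

definition spectral_matrix :: "('n \<Rightarrow> real ^ 'n) \<Rightarrow> real ^ 'n \<Rightarrow> real ^ 'n ^ 'n" where
  "spectral_matrix q v = (\<Sum>i\<in>UNIV. v $ i *\<^sub>R outer (q i) (q i))"

text \<open>
  The diagonal of the matrix of \<open>X\<close> after the change of basis to \<open>q\<close>. It is linear in \<open>X\<close>, which
  the eigenvalues are not; this is what lets it be applied to convex combinations.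
\<close>

definition diagonal_in :: "('n \<Rightarrow> real ^ 'n) \<Rightarrow> real ^ 'n ^ 'n \<Rightarrow> real ^ 'n" where
  "diagonal_in q X = (\<chi> i. q i \<bullet> (X *v q i))"

text \<open>
  For symmetric \<open>f\<close>, the spectra of the matrices in \<open>rank_spectral_set f k\<close>, in every order.
\<close>

definition sparse_spectra :: "(real ^ 'n \<Rightarrow> real) \<Rightarrow> nat \<Rightarrow> (real ^ 'n) set" where
  "sparse_spectra f k = {v. (\<forall>i. 0 \<le> v $ i) \<and> card {i. v $ i \<noteq> 0} \<le> k \<and> f v \<le> 0}"

section \<open>Spectral decomposition of symmetric matrices\<close>

lemma outer_mult_vec: "outer u w *v x = (w \<bullet> x) *\<^sub>R u"
  by (simp add: vec_eq_iff outer_def matrix_vector_mult_def inner_vec_def sum_distrib_left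
      mult_ac)

lemma inner_outer: "outer u w \<bullet> outer u' w' = (u \<bullet> u') * (w \<bullet> w')"
  by (simp add: outer_def inner_vec_def sum_product mult_ac)

lemma symmetric_inner_swap:
  fixes X :: "real ^ 'n ^ 'n"
  assumes "transpose X = X"
  shows "(X *v x) \<bullet> y = x \<bullet> (X *v y)"
  by (metis assms dot_lmul_matrix vector_transpose_matrix)

text \<open>
  A maximiser \<open>u\<close> of the quadratic form on the unit sphere of \<open>S\<close> is an eigenvector: moving from
  \<open>u\<close> in the direction \<open>y\<close> of the residual \<open>X *v u - c *\<^sub>R u\<close> would otherwise increase the form to
  first order.
\<close>

lemma symmetric_eigenvector_in_invariant_subspace:
  fixes X :: "real ^ 'n ^ 'n"
  assumes sym: "transpose X = X" and S: "subspace S"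
    and inv: "\<And>x. x \<in> S \<Longrightarrow> X *v x \<in> S" and ne: "z \<in> S" "z \<noteq> 0"
  obtains u c where "u \<in> S" "norm u = 1" "X *v u = c *\<^sub>R u"
proof -
  let ?Q = "\<lambda>x. x \<bullet> (X *v x)"
  let ?K = "S \<inter> sphere 0 1"
  have "compact ?K"
    using closed_Int_compact[OF closed_subspace[OF S] compact_sphere] .
  moreover have "z /\<^sub>R norm z \<in> ?K" using ne S by (simp add: subspace_scale)
  moreover have "continuous_on ?K ?Q"
    by (intro continuous_intros linear_continuous_on matrix_vector_mul_bounded_linear)
  ultimately obtain u where u: "u \<in> ?K" and max: "\<And>x. x \<in> ?K \<Longrightarrow> ?Q x \<le> ?Q u"
    using continuous_attains_sup[of ?K ?Q] by blast
  define c where "c = ?Q u"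
  have uS: "u \<in> S" and nu: "norm u = 1" and uu: "u \<bullet> u = 1"
    using u by (auto simp: norm_eq_1)
  have le: "?Q x \<le> c * (x \<bullet> x)" if "x \<in> S" for x
  proof (cases "x = 0")
    case False
    then have "x /\<^sub>R norm x \<in> ?K" using that S by (simp add: subspace_scale)
    from max[OF this] have "?Q x / (norm x)^2 \<le> c"
      by (simp add: c_def matrix_vector_mult_scaleR power2_eq_square divide_inverse mult_ac)
    then show ?thesis using False by (simp add: divide_le_eq power2_norm_eq_inner)
  qed simp
  define y where "y = X *v u - c *\<^sub>R u"
  have yS: "y \<in> S" unfolding y_def using inv[OF uS] uS S
    by (simp add: subspace_diff subspace_scale)
  have yu: "y \<bullet> u = 0" unfolding y_def
    by (simp add: inner_diff_left inner_diff_right uu c_def inner_commute)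
  have yX: "y \<bullet> (X *v u) = y \<bullet> y"
  proof -
    have "X *v u = y + c *\<^sub>R u" by (simp add: y_def)
    then show ?thesis using yu by (simp add: inner_add_right)
  qed
  have quad: "2 * t * (y \<bullet> y) \<le> t^2 * (c * (y \<bullet> y) - ?Q y)" for t
  proof -
    have "u + t *\<^sub>R y \<in> S" using uS yS S by (simp add: subspace_add subspace_scale)
    from le[OF this] show ?thesis
      using yu yX symmetric_inner_swap[OF sym, of u y]
      by (simp add: uu c_def[symmetric] inner_commute algebra_simps power2_eq_square)
  qed
  have "y = 0"
  proof (rule ccontr)
    assume "y \<noteq> 0"
    then have p: "0 < y \<bullet> y" by simp
    define M where "M = \<bar>c * (y \<bullet> y) - ?Q y\<bar> + 1"
    have M: "M > 0" "c * (y \<bullet> y) - ?Q y \<le> M" unfolding M_def by auto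
    define t where "t = (y \<bullet> y) / M"
    have t: "t > 0" "t * M = y \<bullet> y" unfolding t_def using p M by auto
    have "2 * t * (y \<bullet> y) \<le> t^2 * M"
      using quad[of t] mult_left_mono[OF M(2), of "t^2"] by simp
    also have "\<dots> = t * (y \<bullet> y)" using t by (simp add: power2_eq_square mult.assoc)
    finally show False using t p by simp
  qed
  then have "X *v u = c *\<^sub>R u" by (simp add: y_def)
  then show thesis using that uS nu by blast
qed

text \<open>
  The orthogonal complement of a set of eigenvectors is invariant, so as long as it is nonzero it
  contains a further eigenvector.
\<close>

lemma spectral_theorem_vectors:
  fixes X :: "real ^ 'n ^ 'n"
  assumes sym: "transpose X = X"
  obtains q :: "'n \<Rightarrow> real ^ 'n" and v where "orthonormal q" "\<And>i. X *v q i = v $ i *\<^sub>R q i"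
proof -
  have "\<exists>B. finite B \<and> card B = m \<and> (\<forall>x\<in>B. \<forall>y\<in>B. x \<bullet> y = (if x = y then 1 else 0)) \<and>
          (\<forall>x\<in>B. \<exists>c. X *v x = c *\<^sub>R x)" if "m \<le> CARD('n)" for m
    using that
  proof (induction m)
    case 0
    show ?case by (rule exI[of _ "{}"]) simp
  next
    case (Suc m)
    then obtain B where B: "finite B" "card B = m"
      and on: "\<And>x y. x \<in> B \<Longrightarrow> y \<in> B \<Longrightarrow> x \<bullet> y = (if x = y then 1 else 0)"
      and eig: "\<And>x. x \<in> B \<Longrightarrow> \<exists>c. X *v x = c *\<^sub>R x"
      by (metis Suc_leD)
    let ?S = "{x. \<forall>b\<in>B. x \<bullet> b = 0}"
    have S: "subspace ?S" by (simp add: subspace_def inner_add_left)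
    have "dim B < DIM(real ^ 'n)" using dim_le_card[of B B] B Suc.prems by (simp add: span_superset)
    then obtain z where "z \<noteq> 0" "\<And>y. y \<in> span B \<Longrightarrow> orthogonal z y"
      using orthogonal_to_subspace_exists by blast
    then have z: "z \<in> ?S" "z \<noteq> 0" by (auto simp: orthogonal_def span_base)
    have inv: "X *v x \<in> ?S" if "x \<in> ?S" for x
      using that eig by (fastforce simp: symmetric_inner_swap[OF sym])
    obtain u c where u: "u \<in> ?S" "norm u = 1" "X *v u = c *\<^sub>R u"
      using symmetric_eigenvector_in_invariant_subspace[OF sym S inv z] by blast
    have "u \<notin> B" using u on by fastforce
    then show ?case using B on eig u
      by (intro exI[of _ "insert u B"]) (auto simp: norm_eq_1 inner_commute)
  qed
  from this[of "CARD('n)"] obtain B where B: "finite B" "card B = CARD('n)"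
    and on: "\<And>x y. x \<in> B \<Longrightarrow> y \<in> B \<Longrightarrow> x \<bullet> y = (if x = y then 1 else 0)"
    and eig: "\<And>x. x \<in> B \<Longrightarrow> \<exists>c. X *v x = c *\<^sub>R x" by blast
  obtain q :: "'n \<Rightarrow> real ^ 'n" where q: "bij_betw q UNIV B"
    using finite_same_card_bij[of "UNIV :: 'n set" B] B by auto
  have qB: "q i \<in> B" for i using q by (auto simp: bij_betw_def)
  have "orthonormal q" unfolding orthonormal_def
    using on qB q by (auto simp: bij_betw_def inj_eq)
  moreover have "\<forall>i. \<exists>c. X *v q i = c *\<^sub>R q i" using eig qB by blast
  then obtain w where "\<And>i. X *v q i = w i *\<^sub>R q i" using choice[of "\<lambda>i c. X *v q i = c *\<^sub>R q i"] by blast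
  ultimately show thesis using that[of q "\<chi> i. w i"] by simp
qed

text \<open>
  The rows of an orthogonal matrix are orthonormal, hence so are its columns.
\<close>

lemma orthonormal_sum_components:
  assumes "orthonormal q"
  shows "(\<Sum>i\<in>UNIV. q i $ r * q i $ c) = (if r = c then 1 else 0)"
proof -
  let ?Q = "\<chi> i. q i"
  have "?Q ** transpose ?Q = mat 1"
    using assms by (simp add: vec_eq_iff matrix_matrix_mult_def transpose_def mat_def
        orthonormal_def inner_vec_def)
  then have "transpose ?Q ** ?Q = mat 1" by (simp add: matrix_left_right_inverse)
  then show ?thesis
    by (simp add: vec_eq_iff matrix_matrix_mult_def transpose_def mat_def)
qed

lemma orthonormal_expansion:
  assumes "orthonormal q"
  shows "(\<Sum>i\<in>UNIV. (q i \<bullet> x) *\<^sub>R q i) = x"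
proof -
  have "(\<Sum>i\<in>UNIV. (q i \<bullet> x) *\<^sub>R q i) $ r = x $ r" for r
  proof -
    have "(\<Sum>i\<in>UNIV. (q i \<bullet> x) *\<^sub>R q i) $ r = (\<Sum>i\<in>UNIV. \<Sum>c\<in>UNIV. q i $ r * q i $ c * x $ c)"
      by (simp add: inner_vec_def sum_distrib_left sum_distrib_right mult_ac)
    also have "\<dots> = (\<Sum>c\<in>UNIV. (\<Sum>i\<in>UNIV. q i $ r * q i $ c) * x $ c)"
      by (subst sum.swap) (simp add: sum_distrib_right)
    also have "\<dots> = x $ r"
      by (simp add: orthonormal_sum_components[OF assms] if_distrib[of "\<lambda>a. a * _"] cong: if_cong)
    finally show ?thesis .
  qed
  then show ?thesis by (simp add: vec_eq_iff)
qed

lemma orthonormal_parseval: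
  assumes "orthonormal q"
  shows "(\<Sum>i\<in>UNIV. (q i \<bullet> x)\<^sup>2) = x \<bullet> x"
proof -
  have "x \<bullet> x = (\<Sum>i\<in>UNIV. (q i \<bullet> x) *\<^sub>R q i) \<bullet> x"
    by (simp add: orthonormal_expansion[OF assms])
  also have "\<dots> = (\<Sum>i\<in>UNIV. (q i \<bullet> x)\<^sup>2)"
    by (simp add: inner_sum_left power2_eq_square)
  finally show ?thesis by simp
qed

lemma spectral_matrix_mult_vec:
  "spectral_matrix q v *v x = (\<Sum>i\<in>UNIV. (v $ i * (q i \<bullet> x)) *\<^sub>R q i)"
proof -
  have "(\<Sum>i\<in>A. v $ i *\<^sub>R outer (q i) (q i)) *v x = (\<Sum>i\<in>A. (v $ i * (q i \<bullet> x)) *\<^sub>R q i)" for A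
    by (induction A rule: infinite_finite_induct)
       (auto simp: matrix_vector_mult_add_rdistrib scaleR_matrix_vector_assoc[symmetric] outer_mult_vec)
  then show ?thesis by (simp add: spectral_matrix_def)
qed

lemma linear_spectral_matrix: "linear (spectral_matrix q)"
  by (rule linearI)
     (simp_all add: spectral_matrix_def scaleR_add_left sum.distrib scaleR_sum_right)

lemma linear_diagonal_in: "linear (diagonal_in q)"
  by (rule linearI)
     (simp_all add: vec_eq_iff diagonal_in_def matrix_vector_mult_add_rdistrib inner_add_right
       scaleR_matrix_vector_assoc[symmetric])

lemma transpose_spectral_matrix: "transpose (spectral_matrix q v) = spectral_matrix q v"
  by (simp add: vec_eq_iff spectral_matrix_def transpose_def outer_def mult.commute)

lemma spectral_theorem:
  fixes X :: "real ^ 'n ^ 'n"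
  assumes "transpose X = X"
  obtains q v where "orthonormal q" "X = spectral_matrix q v"
proof -
  obtain q v where q: "orthonormal q" and e: "\<And>i. X *v q i = v $ i *\<^sub>R q i"
    using spectral_theorem_vectors[OF assms] by blast
  have "X *v x = spectral_matrix q v *v x" for x
  proof -
    have "X *v x = X *v (\<Sum>i\<in>UNIV. (q i \<bullet> x) *\<^sub>R q i)" 
      by (simp add: orthonormal_expansion[OF q])
    also have "\<dots> = (\<Sum>i\<in>UNIV. (q i \<bullet> x) *\<^sub>R (X *v q i))"
      by (simp add: linear_sum matrix_vector_mult_scaleR)
    finally show ?thesis by (simp add: e spectral_matrix_mult_vec mult.commute)
  qed
  then have "X = spectral_matrix q v" by (simp add: matrix_eq)
  with q show thesis using that by blast
qed

lemma orthonormal_inner: "orthonormal q \<Longrightarrow> q i \<bullet> q j = (if i = j then 1 else 0)"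
  by (simp add: orthonormal_def)

text \<open>
  The coefficients \<open>(p i \<bullet> q j)\<^sup>2\<close> form a doubly stochastic matrix when \<open>p\<close> and \<open>q\<close> are
  orthonormal. This is the link from diagonals to majorisation.
\<close>

lemma diagonal_in_spectral_matrix:
  "diagonal_in p (spectral_matrix q v) = (\<chi> i. \<Sum>j\<in>UNIV. (p i \<bullet> q j)\<^sup>2 * v $ j)"
  by (simp add: vec_eq_iff diagonal_in_def spectral_matrix_mult_vec inner_sum_right
      power2_eq_square inner_commute mult_ac)

lemma diagonal_in_same_family: "orthonormal q \<Longrightarrow> diagonal_in q (spectral_matrix q v) = v"
  by (simp add: diagonal_in_spectral_matrix vec_eq_iff orthonormal_inner
       if_distrib[of "\<lambda>a. a\<^sup>2"] if_distrib[of "\<lambda>a. a * _"] cong: if_cong)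

lemma spectral_matrix_psd_iff:
  assumes q: "orthonormal q"
  shows "spectral_matrix q v \<in> psd \<longleftrightarrow> (\<forall>i. 0 \<le> v $ i)"
proof
  assume "spectral_matrix q v \<in> psd"
  then have "0 \<le> diagonal_in q (spectral_matrix q v) $ i" for i
    by (simp add: psd_def diagonal_in_def)
  then show "\<forall>i. 0 \<le> v $ i" by (simp add: diagonal_in_same_family[OF q])
next
  assume "\<forall>i. 0 \<le> v $ i"
  then have "0 \<le> x \<bullet> (spectral_matrix q v *v x)" for x
    by (auto simp: spectral_matrix_mult_vec inner_sum_right inner_commute[of x] mult.assoc
        intro!: sum_nonneg)
  then show "spectral_matrix q v \<in> psd" by (simp add: psd_def transpose_spectral_matrix)
qed

lemma rank_spectral_matrix:
  assumes q: "orthonormal q"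
  shows "rank (spectral_matrix q v) = card {i. v $ i \<noteq> 0}"
proof -
  let ?P = "{i. v $ i \<noteq> 0}" and ?X = "spectral_matrix q v"
  have nz: "q i \<noteq> 0" for i using orthonormal_inner[OF q, of i i] by force
  have inj: "inj q"
    by (rule injI) (metis orthonormal_inner[OF q] zero_neq_one)
  have "range (\<lambda>x. ?X *v x) \<subseteq> span (q ` ?P)"
  proof (clarify)
    fix x
    have "(v $ i * (q i \<bullet> x)) *\<^sub>R q i \<in> span (q ` ?P)" for i
      by (cases "v $ i = 0") (auto simp: span_zero intro: span_scale span_base)
    then show "?X *v x \<in> span (q ` ?P)"
      unfolding spectral_matrix_mult_vec by (intro span_sum)
  qed
  moreover have "q ` ?P \<subseteq> range (\<lambda>x. ?X *v x)"
  proof clarify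
    fix i assume i: "v $ i \<noteq> 0"
    have "(v $ j * (q j \<bullet> ((1 / v $ i) *\<^sub>R q i))) *\<^sub>R q j = (if j = i then q i else 0)" for j
      using i by (simp add: orthonormal_inner[OF q])
    then have "?X *v ((1 / v $ i) *\<^sub>R q i) = q i"
      by (simp add: spectral_matrix_mult_vec)
    then show "q i \<in> range (\<lambda>x. ?X *v x)" by (metis rangeI)
  qed
  ultimately have "rank ?X = dim (q ` ?P)"
    by (metis dim_span dim_subset antisym rank_dim_range)
  also have "\<dots> = card (q ` ?P)"
  proof (rule dim_eq_card_independent)
    have "pairwise orthogonal (q ` ?P)"
      by (auto simp: pairwise_def orthogonal_def orthonormal_inner[OF q])
    then show "independent (q ` ?P)"
      using nz by (intro pairwise_orthogonal_independent) auto
  qed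
  also have "\<dots> = card ?P" by (rule card_image[OF inj_on_subset[OF inj]]) simp
  finally show ?thesis .
qed

lemma det_mat_minus_spectral_matrix:
  assumes q: "orthonormal q"
  shows "det (mat t - spectral_matrix q v) = (\<Prod>i\<in>UNIV. (t - v $ i))"
proof -
  let ?Q = "\<chi> i. q i" and ?d = "(\<chi> i j. if i = j then t - v $ i else 0) :: real^'a^'a"
  have 1: "?Q ** transpose ?Q = mat 1"
    using q by (simp add: vec_eq_iff matrix_matrix_mult_def transpose_def mat_def
        orthonormal_def inner_vec_def)
  have "transpose ?Q ** ?d ** ?Q = mat t - spectral_matrix q v"
  proof -
    have "(transpose ?Q ** ?d ** ?Q) $ r $ c = (mat t - spectral_matrix q v) $ r $ c" for r c
    proof -
      have "(transpose ?Q ** ?d ** ?Q) $ r $ c = (\<Sum>i\<in>UNIV. q i $ r * (t - v $ i) * q i $ c)"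
      proof -
        have "(transpose ?Q ** ?d) $ r $ i = (\<Sum>k\<in>UNIV. if k = i then q i $ r * (t - v $ i) else 0)" for i
          unfolding matrix_matrix_mult_def transpose_def vec_lambda_beta
          by (rule sum.cong) auto
        then have "(transpose ?Q ** ?d) $ r $ i = q i $ r * (t - v $ i)" for i
          by simp
        then show ?thesis
          unfolding matrix_matrix_mult_def[of "transpose ?Q ** ?d"] vec_lambda_beta by simp
      qed
      also have "\<dots> = t * (\<Sum>i\<in>UNIV. q i $ r * q i $ c) - (\<Sum>i\<in>UNIV. v $ i * (q i $ r * q i $ c))"
        by (simp add: sum_distrib_left sum_subtractf algebra_simps)
      also have "\<dots> = (mat t - spectral_matrix q v) $ r $ c"
        by (simp add: orthonormal_sum_components[OF q] mat_def spectral_matrix_def outer_def)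
      finally show ?thesis .
    qed
    then show ?thesis by (simp add: vec_eq_iff)
  qed
  then have "det (mat t - spectral_matrix q v) = det (transpose ?Q ** ?d ** ?Q)" by (rule arg_cong[OF sym])
  also have "\<dots> = det (transpose ?Q) * det ?d * det ?Q" by (simp only: det_mul)
  also have "\<dots> = det (?Q ** transpose ?Q) * det ?d" by (simp add: det_mul)
  also have "\<dots> = (\<Prod>i\<in>UNIV. (t - v $ i))"
    by (simp add: 1 det_diagonal)
  finally show ?thesis .
qed

text \<open>
  Both products are values of monic polynomials, which agree as polynomials and thus have the same
  multiset of roots.
\<close>

lemma monic_roots_unique_up_to_permutation:
  fixes v w :: "real ^ 'n"
  assumes "\<And>t. (\<Prod>i\<in>UNIV. (t - v $ i)) = (\<Prod>i\<in>UNIV. (t - w $ i))"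
  obtains p where "p permutes UNIV" "w = (\<chi> i. v $ p i)"
proof -
  define P where "P x = (\<Prod>i\<in>UNIV. [:- (x $ i), 1:])" for x :: "real ^ 'n"
  have "poly (P v) = poly (P w)"
    using assms by (simp add: P_def fun_eq_iff poly_prod)
  then have "P v = P w" by (simp add: poly_eq_poly_eq_iff)
  moreover have "proots (P x) = image_mset (\<lambda>i. x $ i) (mset_set UNIV)" for x
    unfolding P_def by (subst proots_prod) (auto simp: sum_unfold_sum_mset)
  ultimately have "image_mset (\<lambda>i. w $ i) (mset_set UNIV) = image_mset (\<lambda>i. v $ i) (mset_set UNIV)"
    by metis
  from image_mset_eq_implies_permutes[OF _ this] obtain p
    where "p permutes UNIV" "\<forall>i\<in>UNIV. w $ i = v $ p i" by auto
  then show thesis using that[of p] by (simp add: vec_eq_iff)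
qed

text \<open>
  The listing chosen by \<open>eigvals\<close> is a rearrangement of \<open>v\<close>, and \<open>f\<close> does not see the order.
\<close>

lemma symmetric_fun_eigvals:
  assumes f: "symmetric_fun f" and q: "orthonormal q"
  shows "f (eigvals (spectral_matrix q v)) = f v"
proof -
  let ?w = "eigvals (spectral_matrix q v)"
  have "\<forall>t. det (mat t - spectral_matrix q v) = (\<Prod>i\<in>UNIV. (t - ?w $ i))"
    unfolding eigvals_def
    by (rule someI[of _ v]) (simp add: det_mat_minus_spectral_matrix[OF q])
  then have "(\<Prod>i\<in>UNIV. (t - v $ i)) = (\<Prod>i\<in>UNIV. (t - ?w $ i))" for t
    by (simp add: det_mat_minus_spectral_matrix[OF q])
  then obtain p where "p permutes UNIV" "?w = (\<chi> i. v $ p i)"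
    using monic_roots_unique_up_to_permutation[of v ?w] by blast
  then show ?thesis using f by (simp add: symmetric_fun_def)
qed

lemma spectral_matrix_in_rank_spectral_set_iff:
  assumes "symmetric_fun f" and "orthonormal q"
  shows "spectral_matrix q v \<in> rank_spectral_set f k \<longleftrightarrow> v \<in> sparse_spectra f k"
  using assms
  by (simp add: rank_spectral_set_def sparse_spectra_def spectral_matrix_psd_iff
      rank_spectral_matrix symmetric_fun_eigvals)

section \<open>Doubly stochastic matrices and rearrangements\<close>

text \<open>
  The rearrangement inequality in the form that an induction on \<open>S\<close> can prove. Let \<open>e\<close> be the index
  where both \<open>c\<close> and \<open>x\<close> are smallest. After \<open>c e\<close> and \<open>x e\<close> are subtracted, row and column \<open>e\<close>
  contribute nothing, so \<open>e\<close> can be deleted from \<open>S\<close>. What is left of the matrix is only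
  substochastic, which is why equality is not demanded of the row and column sums; the terms removed by the
  subtraction still compare in the right direction because \<open>c\<close> and \<open>x\<close> are nonnegative.
\<close>

lemma similarly_ordered_substochastic_le:
  fixes P :: "'a \<Rightarrow> 'a \<Rightarrow> real" and c x :: "'a \<Rightarrow> real"
  assumes "finite S"
    and "\<And>i j. 0 \<le> P i j"
    and "\<And>i. i \<in> S \<Longrightarrow> (\<Sum>j\<in>S. P i j) \<le> 1" and "\<And>j. j \<in> S \<Longrightarrow> (\<Sum>i\<in>S. P i j) \<le> 1"
    and "\<And>i. i \<in> S \<Longrightarrow> 0 \<le> c i" and "\<And>i. i \<in> S \<Longrightarrow> 0 \<le> x i"
    and "\<And>i j. i \<in> S \<Longrightarrow> j \<in> S \<Longrightarrow> 0 \<le> (c i - c j) * (x i - x j)"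
  shows "(\<Sum>i\<in>S. \<Sum>j\<in>S. P i j * (c i * x j)) \<le> (\<Sum>i\<in>S. c i * x i)"
  using assms
proof (induction "card S" arbitrary: S c x)
  case 0
  then show ?case by simp
next
  case (Suc n)
  note fin = Suc.prems(1) and P = Suc.prems(2) and row = Suc.prems(3) and col = Suc.prems(4)
    and c0 = Suc.prems(5) and x0 = Suc.prems(6) and ord = Suc.prems(7)
  have "S \<noteq> {}" using Suc.hyps(2) by auto
  \<comment> \<open>Minimising the sum minimises both summands, as the two functions are similarly ordered.\<close>
  then obtain e where eS: "e \<in> S" and least: "\<And>i. i \<in> S \<Longrightarrow> c e + x e \<le> c i + x i"
    using ex_min_if_finite[of "(\<lambda>i. c i + x i) ` S"] fin
    by (metis (mono_tags, lifting) arg_min_if_finite(1) arg_min_least)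
  have cm: "c e \<le> c i" and xm: "x e \<le> x i" if "i \<in> S" for i
    using least[OF that] ord[OF that eS]
    by (auto simp: zero_le_mult_iff intro: ccontr)
  define c' x' where "c' i = c i - c e" and "x' i = x i - x e" for i
  have z: "c' e = 0" "x' e = 0" by (auto simp: c'_def x'_def)
  have n: "0 \<le> c' i" "0 \<le> x' i" if "i \<in> S" for i using cm xm that by (auto simp: c'_def x'_def)
  let ?S = "S - {e}"
  have sub: "(\<Sum>j\<in>?S. P i j) \<le> (\<Sum>j\<in>S. P i j)" "(\<Sum>j\<in>?S. P j i) \<le> (\<Sum>j\<in>S. P j i)" for i
    using fin P by (auto intro!: sum_mono2)
  have "(\<Sum>i\<in>?S. \<Sum>j\<in>?S. P i j * (c' i * x' j)) \<le> (\<Sum>i\<in>?S. c' i * x' i)"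
  proof (rule Suc.hyps(1))
    show "n = card ?S" using Suc.hyps(2) eS fin by simp
    show "0 \<le> (c' i - c' j) * (x' i - x' j)" if "i \<in> ?S" "j \<in> ?S" for i j
      using ord that by (simp add: c'_def x'_def)
    show "(\<Sum>j\<in>?S. P i j) \<le> 1" if "i \<in> ?S" for i
      using sub(1)[of i] row[of i] that by simp
    show "(\<Sum>i\<in>?S. P i j) \<le> 1" if "j \<in> ?S" for j
      using sub(2)[of j] col[of j] that by simp
  qed (use fin P n in auto)
  moreover have "(\<Sum>i\<in>?S. c' i * x' i) = (\<Sum>i\<in>S. c' i * x' i)"
    using fin z by (intro sum.mono_neutral_left) auto
  moreover have "(\<Sum>i\<in>?S. \<Sum>j\<in>?S. P i j * (c' i * x' j)) = (\<Sum>i\<in>S. \<Sum>j\<in>S. P i j * (c' i * x' j))"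
  proof -
    have "(\<Sum>j\<in>?S. P i j * (c' i * x' j)) = (\<Sum>j\<in>S. P i j * (c' i * x' j))" for i
      using fin z by (intro sum.mono_neutral_left) auto
    moreover have "(\<Sum>i\<in>?S. \<Sum>j\<in>S. P i j * (c' i * x' j)) = (\<Sum>i\<in>S. \<Sum>j\<in>S. P i j * (c' i * x' j))"
      using fin z by (intro sum.mono_neutral_left) auto
    ultimately show ?thesis by simp
  qed
  ultimately have IH: "(\<Sum>i\<in>S. \<Sum>j\<in>S. P i j * (c' i * x' j)) \<le> (\<Sum>i\<in>S. c' i * x' i)" by simp
  have "(\<Sum>i\<in>S. \<Sum>j\<in>S. P i j * (c i * x j)) =
      (\<Sum>i\<in>S. \<Sum>j\<in>S. P i j * (c' i * x' j)) + c e * (\<Sum>j\<in>S. (\<Sum>i\<in>S. P i j) * x' j)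
      + x e * (\<Sum>i\<in>S. (\<Sum>j\<in>S. P i j) * c' i) + c e * x e * (\<Sum>i\<in>S. \<Sum>j\<in>S. P i j)"
  proof -
    have "(\<Sum>j\<in>S. (\<Sum>i\<in>S. P i j) * x' j) = (\<Sum>i\<in>S. \<Sum>j\<in>S. P i j * x' j)"
      by (subst sum.swap) (simp add: sum_distrib_right)
    moreover have "P i j * (c i * x j) = P i j * (c' i * x' j) + c e * (P i j * x' j)
        + x e * (P i j * c' i) + c e * x e * P i j" for i j
      by (simp add: c'_def x'_def algebra_simps)
    ultimately show ?thesis
      by (simp add: sum.distrib sum_distrib_left sum_distrib_right)
  qed
  also have "\<dots> \<le> (\<Sum>i\<in>S. c' i * x' i) + c e * (\<Sum>j\<in>S. 1 * x' j)
      + x e * (\<Sum>i\<in>S. 1 * c' i) + c e * x e * (\<Sum>i\<in>S. 1)"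
    using eS c0 x0 n row col
    by (intro add_mono IH mult_left_mono sum_mono mult_right_mono) auto
  also have "\<dots> = (\<Sum>i\<in>S. c i * x i)"
  proof -
    have "(\<Sum>i\<in>S. c i * x i) = (\<Sum>i\<in>S. c' i * x' i + c e * x' i + x e * c' i + c e * x e)"
      by (rule sum.cong) (simp_all add: c'_def x'_def algebra_simps)
    then show ?thesis by (simp add: sum.distrib sum_distrib_left)
  qed
  finally show ?case .
qed

text \<open>
  With all row and column sums equal to one, a shift of \<open>c\<close> or \<open>x\<close> by a constant changes both
  sides equally, so the sign conditions disappear.
\<close>

lemma similarly_ordered_doubly_stochastic_le:
  fixes P :: "'n::finite \<Rightarrow> 'n \<Rightarrow> real" and c x :: "'n \<Rightarrow> real"
  assumes P: "\<And>i j. 0 \<le> P i j"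
    and row: "\<And>i. (\<Sum>j\<in>UNIV. P i j) = 1" and col: "\<And>j. (\<Sum>i\<in>UNIV. P i j) = 1"
    and ord: "\<And>i j. 0 \<le> (c i - c j) * (x i - x j)"
  shows "(\<Sum>i\<in>UNIV. c i * (\<Sum>j\<in>UNIV. P i j * x j)) \<le> (\<Sum>i\<in>UNIV. c i * x i)"
proof -
  define m l where "m = Min (range c)" and "l = Min (range x)"
  have ml: "m \<le> c i" "l \<le> x i" for i by (simp_all add: m_def l_def)
  let ?N = "\<Sum>i\<in>(UNIV::'n set). m * l"
  have "(\<Sum>i\<in>UNIV. \<Sum>j\<in>UNIV. P i j * ((c i - m) * (x j - l))) \<le> (\<Sum>i\<in>UNIV. (c i - m) * (x i - l))"
    by (rule similarly_ordered_substochastic_le) (use P row col ord ml in auto)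
  moreover have "(\<Sum>i\<in>UNIV. \<Sum>j\<in>UNIV. P i j * ((c i - m) * (x j - l)))
     = (\<Sum>i\<in>UNIV. c i * (\<Sum>j\<in>UNIV. P i j * x j)) - m * (\<Sum>i\<in>UNIV. x i) - l * (\<Sum>i\<in>UNIV. c i) + ?N"
  proof -
    have s: "(\<Sum>i\<in>UNIV. \<Sum>j\<in>UNIV. P i j * x j) = (\<Sum>j\<in>UNIV. x j)"
      by (subst sum.swap) (simp add: sum_distrib_right[symmetric] col)
    have "(\<Sum>j\<in>UNIV. P i j * ((c i - m) * (x j - l))) =
        c i * (\<Sum>j\<in>UNIV. P i j * x j) - m * (\<Sum>j\<in>UNIV. P i j * x j) - l * c i + m * l" for i
    proof -
      have "P i j * ((c i - m) * (x j - l)) =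
          c i * (P i j * x j) - m * (P i j * x j) - l * c i * P i j + m * l * P i j" for j
        by (simp add: algebra_simps)
      then have "(\<Sum>j\<in>UNIV. P i j * ((c i - m) * (x j - l))) =
          c i * (\<Sum>j\<in>UNIV. P i j * x j) - m * (\<Sum>j\<in>UNIV. P i j * x j)
          - l * c i * (\<Sum>j\<in>UNIV. P i j) + m * l * (\<Sum>j\<in>UNIV. P i j)"
        by (simp only: sum.distrib sum_subtractf sum_distrib_left)
      then show ?thesis by (simp add: row)
    qed
    then have "(\<Sum>i\<in>UNIV. \<Sum>j\<in>UNIV. P i j * ((c i - m) * (x j - l))) =
      (\<Sum>i\<in>UNIV. c i * (\<Sum>j\<in>UNIV. P i j * x j)) - m * (\<Sum>i\<in>UNIV. \<Sum>j\<in>UNIV. P i j * x j)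
      - l * (\<Sum>i\<in>UNIV. c i) + ?N"
      by (simp only: sum.distrib sum_subtractf sum_distrib_left)
    then show ?thesis by (simp only: s)
  qed
  moreover have "(\<Sum>i\<in>UNIV. (c i - m) * (x i - l))
     = (\<Sum>i\<in>UNIV. c i * x i) - m * (\<Sum>i\<in>UNIV. x i) - l * (\<Sum>i\<in>UNIV. c i) + ?N"
  proof -
    have "(c i - m) * (x i - l) = c i * x i - m * x i - l * c i + m * l" for i
      by (simp add: algebra_simps)
    then show ?thesis by (simp only: sum.distrib sum_subtractf sum_distrib_left)
  qed
  ultimately show ?thesis by linarith
qed

lemma swap_entries:
  fixes y :: "real ^ 'n"
  shows "(\<chi> i. y $ Transposition.transpose a b i) = y - (y $ a - y $ b) *\<^sub>R (axis a 1 - axis b 1)"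
  by (auto simp: vec_eq_iff axis_def Transposition.transpose_def)

definition rearrangements :: "real ^ 'n \<Rightarrow> (real ^ 'n) set" where
  "rearrangements x = (\<lambda>p. \<chi> i. x $ p i) ` {p. p permutes UNIV}"

text \<open>
  A point outside the polytope spanned by the rearrangements of \<open>x\<close> is strictly separated from it by
  a linear functional \<open>a\<close>. The rearrangement \<open>w\<close> on which \<open>a\<close> is smallest is ordered oppositely to
  \<open>a\<close>, since no swap of two entries improves it; by the rearrangement inequality \<open>a\<close> is at least as
  large on every doubly stochastic image of \<open>w\<close>.
\<close>

theorem doubly_stochastic_image_in_hull:
  fixes x :: "real ^ 'n" and P :: "'n \<Rightarrow> 'n \<Rightarrow> real"
  assumes P: "\<And>i j. 0 \<le> P i j"
    and row: "\<And>i. (\<Sum>j\<in>UNIV. P i j) = 1" and col: "\<And>j. (\<Sum>i\<in>UNIV. P i j) = 1"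
  shows "(\<chi> i. \<Sum>j\<in>UNIV. P i j * x $ j) \<in> convex hull (rearrangements x)" (is "?y \<in> ?H")
proof (rule ccontr)
  assume "?y \<notin> ?H"
  have fin: "finite (rearrangements x)"
    unfolding rearrangements_def by (intro finite_imageI finite_permutations) simp
  have "closed ?H"
    using fin by (simp add: compact_imp_closed finite_imp_compact_convex_hull)
  then obtain a b where ay: "a \<bullet> ?y < b" and aH: "\<And>z. z \<in> ?H \<Longrightarrow> b < a \<bullet> z"
    using separating_hyperplane_closed_point[of ?H ?y] \<open>?y \<notin> ?H\<close> by auto
  have "x \<in> rearrangements x" unfolding rearrangements_def
    by (rule image_eqI[of _ _ id]) auto
  then have "Min ((\<bullet>) a ` rearrangements x) \<in> (\<bullet>) a ` rearrangements x"
    using fin by (intro Min_in) auto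
  then obtain w where w: "w \<in> rearrangements x" and "a \<bullet> w = Min ((\<bullet>) a ` rearrangements x)"
    by auto
  then have min: "a \<bullet> w \<le> a \<bullet> w'" if "w' \<in> rearrangements x" for w'
    using fin that by simp
  obtain p where p: "p permutes UNIV" and wp: "w = (\<chi> i. x $ p i)"
    using w unfolding rearrangements_def by auto
  have ord: "0 \<le> (- a $ i - - a $ j) * (w $ i - w $ j)" for i j
  proof -
    have "(\<chi> l. w $ Transposition.transpose i j l) = (\<chi> l. x $ (p \<circ> Transposition.transpose i j) l)" by (simp add: wp)
    moreover have "(p \<circ> Transposition.transpose i j) permutes UNIV"
      using p by (intro permutes_compose permutes_swap_id) auto
    ultimately have "(\<chi> l. w $ Transposition.transpose i j l) \<in> rearrangements x"
      unfolding rearrangements_def by blast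
    from min[OF this] show ?thesis
      by (simp add: swap_entries inner_axis algebra_simps)
  qed
  \<comment> \<open>The columns of the matrix are reindexed so that it acts on the rearrangement instead of \<open>x\<close>.\<close>
  have re: "(\<Sum>j\<in>UNIV. g (p j)) = (\<Sum>j\<in>UNIV. g j)" for g :: "'n \<Rightarrow> real"
    using sum.permute[OF p, of g] by (simp add: o_def)
  have "(\<Sum>i\<in>UNIV. - a $ i * (\<Sum>j\<in>UNIV. P i (p j) * w $ j)) \<le> (\<Sum>i\<in>UNIV. - a $ i * w $ i)"
  proof (rule similarly_ordered_doubly_stochastic_le)
    show "(\<Sum>j\<in>UNIV. P i (p j)) = 1" for i using re[of "P i"] row by simp
  qed (use P col ord in auto)
  moreover have "(\<Sum>j\<in>UNIV. P i (p j) * w $ j) = ?y $ i" for i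
    using re[of "\<lambda>j. P i j * x $ j"] by (simp add: wp)
  ultimately have "a \<bullet> w \<le> a \<bullet> ?y"
    by (simp add: inner_vec_def sum_negf)
  moreover have "b < a \<bullet> w" using aH hull_inc[OF w] by blast
  ultimately show False using ay by linarith
qed

section \<open>Exchanges in the hull of the sparse spectra\<close>

lemma rearrangements_sparse_spectra:
  assumes f: "symmetric_fun f" and x: "x \<in> sparse_spectra f k"
  shows "rearrangements x \<subseteq> sparse_spectra f k"
proof
  fix y assume "y \<in> rearrangements x"
  then obtain p where p: "p permutes UNIV" and y: "y = (\<chi> i. x $ p i)"
    unfolding rearrangements_def by auto
  have "p ` {i. x $ p i \<noteq> 0} = {i. x $ i \<noteq> 0}"
    using permutes_surj[OF p] by (auto simp: image_iff)
  then have "card {i. x $ p i \<noteq> 0} = card {i. x $ i \<noteq> 0}"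
    by (metis card_image inj_on_subset permutes_inj[OF p] subset_UNIV)
  then show "y \<in> sparse_spectra f k"
    using x f p by (simp add: sparse_spectra_def y symmetric_fun_def)
qed

lemma swap_in_rearrangements:
  "y - (y $ a - y $ b) *\<^sub>R (axis a 1 - axis b 1) \<in> rearrangements y"
  unfolding rearrangements_def swap_entries[symmetric]
  by (rule image_eqI[OF refl]) (simp add: permutes_swap_id)

lemma swap_in_hull_sparse_spectra:
  assumes f: "symmetric_fun f" and y: "y \<in> convex hull (sparse_spectra f k)"
  shows "y - (y $ a - y $ b) *\<^sub>R (axis a 1 - axis b 1) \<in> convex hull (sparse_spectra f k)"
proof -
  let ?s = "\<lambda>y::real^'a. y - (y $ a - y $ b) *\<^sub>R (axis a 1 - axis b 1)"
  have "linear ?s" by (rule linearI) (auto simp: algebra_simps)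
  then have "?s ` (convex hull (sparse_spectra f k)) = convex hull (?s ` sparse_spectra f k)"
    by (rule convex_hull_linear_image)
  moreover have "?s ` sparse_spectra f k \<subseteq> sparse_spectra f k"
    using rearrangements_sparse_spectra[OF f] swap_in_rearrangements by blast
  ultimately show ?thesis using y hull_mono by blast
qed

text \<open>
  A vector and its image under the swap of entries \<open>a\<close> and \<open>b\<close> both lie in the hull; moving part of
  the excess of entry \<open>a\<close> over to entry \<open>b\<close> stays on the segment between them.
\<close>

lemma transfer_in_hull_sparse_spectra:
  assumes f: "symmetric_fun f" and y: "y \<in> convex hull (sparse_spectra f k)"
    and t: "0 \<le> t" "t \<le> y $ a - y $ b"
  shows "y - t *\<^sub>R (axis a 1 - axis b 1) \<in> convex hull (sparse_spectra f k)"
proof (cases "t = 0")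
  case False
  let ?d = "axis a 1 - axis b 1" and ?g = "y $ a - y $ b"
  have g: "0 < ?g" using t False by linarith
  have "(1 - t / ?g) *\<^sub>R y + (t / ?g) *\<^sub>R (y - ?g *\<^sub>R ?d) \<in> convex hull (sparse_spectra f k)"
    using t g by (intro convexD[OF convex_convex_hull] y swap_in_hull_sparse_spectra[OF f]) auto
  also have "(1 - t / ?g) *\<^sub>R y + (t / ?g) *\<^sub>R (y - ?g *\<^sub>R ?d) = y - t *\<^sub>R ?d"
  proof -
    have "(1 - t / r) *\<^sub>R y + (t / r) *\<^sub>R (y - r *\<^sub>R d) = y - t *\<^sub>R d" if "0 < r" for r and d :: "real ^ 'a"
      using that by (simp add: scaleR_diff_right scaleR_diff_left)
    then show ?thesis using g by blast
  qed
  finally show ?thesis .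
qed (use y in simp)

text \<open>
  This is where sparsity enters. A vector with at most \<open>k\<close> nonzero entries vanishes somewhere on
  \<open>insert b T\<close>; if its entry at \<open>b\<close> is positive, it vanishes at some \<open>c \<in> T\<close>, and swapping \<open>b\<close> and
  \<open>c\<close> moves the whole entry from \<open>b\<close> to \<open>c\<close>. If \<open>y\<close> is a convex combination of such vectors and
  \<open>y $ b > 0\<close>, then a summand has a positive entry at \<open>b\<close>, and swapping it moves a part of the mass
  of \<open>y\<close>.
\<close>

lemma move_mass_into_larger_set:
  assumes f: "symmetric_fun f" and y: "y \<in> convex hull (sparse_spectra f k)"
    and T: "k < card (insert b T)" and b: "0 < y $ b"
  shows "\<exists>c\<in>T. c \<noteq> b \<and> (\<exists>t>0. y + t *\<^sub>R (axis c 1 - axis b 1) \<in> convex hull (sparse_spectra f k))"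
proof -
  let ?C = "convex hull (sparse_spectra f k)"
  let ?G = "\<lambda>y. \<exists>c\<in>T. c \<noteq> b \<and> (\<exists>t>0. y + t *\<^sub>R (axis c 1 - axis b 1) \<in> ?C)"
  let ?A = "{y \<in> ?C. 0 < y $ b \<longrightarrow> ?G y}"
  \<comment> \<open>The claim defines a convex set that contains the generators of the hull.\<close>
  have "sparse_spectra f k \<subseteq> ?A"
  proof
    fix x assume x: "x \<in> sparse_spectra f k"
    have "?G x" if xb: "0 < x $ b"
    proof -
      have "\<not> insert b T \<subseteq> {i. x $ i \<noteq> 0}"
        using T x card_mono[of "{i. x $ i \<noteq> 0}" "insert b T"] by (auto simp: sparse_spectra_def)
      then obtain c where "c \<in> insert b T" "x $ c = 0" by blast
      with xb have c: "c \<in> T" "x $ c = 0" "c \<noteq> b" by auto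
      have "x - (x $ c - x $ b) *\<^sub>R (axis c 1 - axis b 1) \<in> ?C"
        by (rule swap_in_hull_sparse_spectra[OF f hull_inc[OF x]])
      then have "x + x $ b *\<^sub>R (axis c 1 - axis b 1) \<in> ?C" using c by simp
      then show ?thesis using c xb by blast
    qed
    then show "x \<in> ?A" using hull_inc[OF x] by blast
  qed
  moreover have "convex ?A"
  proof (rule convexI)
    have scaled: "?G (u *\<^sub>R x + v *\<^sub>R z)"
      if "x \<in> ?C" "z \<in> ?C" "?G x" "0 < u" "0 \<le> v" "u + v = 1" for x z u v
    proof -
      obtain c t where c: "c \<in> T" "c \<noteq> b" and t: "0 < t"
        and xt: "x + t *\<^sub>R (axis c 1 - axis b 1) \<in> ?C" using \<open>?G x\<close> by blast
      have "u *\<^sub>R (x + t *\<^sub>R (axis c 1 - axis b 1)) + v *\<^sub>R z \<in> ?C"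
        using that by (intro convexD[OF convex_convex_hull] xt) auto
      then have "u *\<^sub>R x + v *\<^sub>R z + (u * t) *\<^sub>R (axis c 1 - axis b 1) \<in> ?C"
        by (simp add: scaleR_add_right add_ac)
      moreover have "0 < u * t" using t that by simp
      ultimately show ?thesis using c by blast
    qed
    fix x z u v assume xz: "x \<in> ?A" "z \<in> ?A" and uv: "0 \<le> u" "0 \<le> v" "u + v = (1::real)"
    have "?G (u *\<^sub>R x + v *\<^sub>R z)" if "0 < (u *\<^sub>R x + v *\<^sub>R z) $ b"
    proof -
      have "0 < u * x $ b + v * z $ b" using that by simp
      then have "0 < u * x $ b \<or> 0 < v * z $ b" by linarith
      then consider "0 < u" "0 < x $ b" | "0 < v" "0 < z $ b"
        using uv by (auto simp: zero_less_mult_iff)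
      then show ?thesis
      proof cases
        case 1
        then show ?thesis using xz uv by (intro scaled) auto
      next
        case 2
        have "?G (v *\<^sub>R z + u *\<^sub>R x)" using 2 xz uv by (intro scaled) auto
        then show ?thesis by (simp add: add.commute)
      qed
    qed
    moreover have "u *\<^sub>R x + v *\<^sub>R z \<in> ?C"
      using xz uv by (intro convexD[OF convex_convex_hull]) auto
    ultimately show "u *\<^sub>R x + v *\<^sub>R z \<in> ?A" by blast
  qed
  ultimately have "?C \<subseteq> ?A" by (rule hull_minimal)
  then show ?thesis using y b by blast
qed

text \<open>
  Entries \<open>a\<close> and \<open>b\<close> can be driven apart, which convex combinations of rearrangements of \<open>y\<close> alone
  cannot do in general. Some mass moves from \<open>b\<close> to an index \<open>c\<close> of \<open>insert a T\<close>. If \<open>c \<noteq> a\<close>, then entry \<open>c\<close>,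
  which was at least as large as entry \<open>a\<close>, now exceeds it by at least the amount moved, so that
  amount can be passed on from \<open>c\<close> to \<open>a\<close>.
\<close>

lemma spread_two_small_entries:
  assumes f: "symmetric_fun f" and y: "y \<in> convex hull (sparse_spectra f k)"
    and card: "k < card (insert b (insert a T))" and b: "0 < y $ b" and ab: "a \<noteq> b"
    and T: "\<And>c. c \<in> T \<Longrightarrow> y $ a \<le> y $ c"
  shows "\<exists>t>0. y + t *\<^sub>R (axis a 1 - axis b 1) \<in> convex hull (sparse_spectra f k)"
proof -
  let ?C = "convex hull (sparse_spectra f k)"
  obtain c t where c: "c \<in> insert a T" "c \<noteq> b" and t: "0 < t"
    and yt: "y + t *\<^sub>R (axis c 1 - axis b 1) \<in> ?C"
    using move_mass_into_larger_set[OF f y card b] by blast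
  show ?thesis
  proof (cases "c = a")
    case True
    then show ?thesis using t yt by blast
  next
    case False
    let ?z = "y + t *\<^sub>R (axis c 1 - axis b 1)"
    have "t \<le> ?z $ c - ?z $ a"
      using T[of c] c False ab by (simp add: axis_def)
    then have "?z - t *\<^sub>R (axis c 1 - axis a 1) \<in> ?C"
      using t by (intro transfer_in_hull_sparse_spectra[OF f yt]) auto
    moreover have "?z - t *\<^sub>R (axis c 1 - axis a 1) = y + t *\<^sub>R (axis a 1 - axis b 1)"
      by (simp add: algebra_simps)
    ultimately show ?thesis using t by metis
  qed
qed

section \<open>The hull of matrices and the hull of spectra\<close>

text \<open>
  By linearity of the diagonal it suffices to treat a single matrix of the generating set; its
  diagonal is the image of its spectrum under a doubly stochastic matrix.
\<close>

lemma diagonal_in_hull: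
  fixes f :: "real ^ 'n \<Rightarrow> real"
  assumes f: "symmetric_fun f" and q: "orthonormal q"
    and X: "X \<in> convex hull (rank_spectral_set f k)"
  shows "diagonal_in q X \<in> convex hull (sparse_spectra f k)"
proof -
  have "diagonal_in q Y \<in> convex hull (sparse_spectra f k)" if Y: "Y \<in> rank_spectral_set f k" for Y
  proof -
    have "Finite_Cartesian_Product.transpose Y = Y" using Y by (simp add: rank_spectral_set_def psd_def)
    then obtain p w where p: "orthonormal p" and Yw: "Y = spectral_matrix p w"
      by (rule spectral_theorem)
    have w: "w \<in> sparse_spectra f k"
      using Y spectral_matrix_in_rank_spectral_set_iff[OF f p] by (simp add: Yw)
    have unit: "q i \<bullet> q i = 1" "p i \<bullet> p i = 1" for i using p q by (simp_all add: orthonormal_inner)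
    have "diagonal_in q Y \<in> convex hull (rearrangements w)"
      unfolding Yw diagonal_in_spectral_matrix
    proof (rule doubly_stochastic_image_in_hull)
      show "(\<Sum>i\<in>UNIV. (q i \<bullet> p j)\<^sup>2) = 1" for j
        by (simp add: orthonormal_parseval[OF q] unit)
      show "(\<Sum>j\<in>UNIV. (q i \<bullet> p j)\<^sup>2) = 1" for i
        using orthonormal_parseval[OF p, of "q i"] by (simp add: unit inner_commute)
    qed simp
    then show ?thesis
      using hull_mono[OF rearrangements_sparse_spectra[OF f w]] by blast
  qed
  then have "convex hull (diagonal_in q ` rank_spectral_set f k) \<subseteq> convex hull (sparse_spectra f k)"
    by (intro hull_minimal) auto
  then show ?thesis
    using X convex_hull_linear_image[OF linear_diagonal_in[of q], of "rank_spectral_set f k"] by blast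
qed

text \<open>
  Membership of a matrix in the hull is a property of its spectrum alone; in particular the
  orthonormal basis \<open>q\<close> may be changed freely.
\<close>

lemma spectral_matrix_in_hull_iff:
  assumes f: "symmetric_fun f" and q: "orthonormal q"
  shows "spectral_matrix q v \<in> convex hull (rank_spectral_set f k) \<longleftrightarrow>
    v \<in> convex hull (sparse_spectra f k)"
proof
  assume "spectral_matrix q v \<in> convex hull (rank_spectral_set f k)"
  from diagonal_in_hull[OF f q this] show "v \<in> convex hull (sparse_spectra f k)"
    by (simp add: diagonal_in_same_family[OF q])
next
  assume "v \<in> convex hull (sparse_spectra f k)"
  then have "spectral_matrix q v \<in> convex hull (spectral_matrix q ` sparse_spectra f k)"
    by (metis convex_hull_linear_image[OF linear_spectral_matrix] imageI)
  moreover have "spectral_matrix q ` sparse_spectra f k \<subseteq> rank_spectral_set f k"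
    using spectral_matrix_in_rank_spectral_set_iff[OF f q] by blast
  ultimately show "spectral_matrix q v \<in> convex hull (rank_spectral_set f k)"
    using hull_mono by blast
qed

section \<open>Feasible directions and faces\<close>

definition feasible_directions :: "'a::real_vector set \<Rightarrow> 'a \<Rightarrow> 'a set" where
  "feasible_directions K x = {d. \<exists>t>0. x + t *\<^sub>R d \<in> K}"

definition two_sided_directions :: "'a::real_vector set \<Rightarrow> 'a \<Rightarrow> 'a set" where
  "two_sided_directions K x = {d \<in> feasible_directions K x. - d \<in> feasible_directions K x}"

text \<open>
  A weighted mean of the two feasible points, with the weights that make both step lengths equal.
\<close>

lemma feasible_directions_add:
  assumes K: "convex K" and a: "a \<in> feasible_directions K x" and b: "b \<in> feasible_directions K x"
  shows "a + b \<in> feasible_directions K x"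
proof -
  obtain s t where s: "0 < s" "x + s *\<^sub>R a \<in> K" and t: "0 < t" "x + t *\<^sub>R b \<in> K"
    using a b by (auto simp: feasible_directions_def)
  define r where "r = s * t / (s + t)"
  have st: "s + t \<noteq> 0" using s t by linarith
  have w: "t / (s + t) + s / (s + t) = 1" using st by (simp add: add_divide_distrib[symmetric] add.commute)
  have "(t / (s + t)) *\<^sub>R (x + s *\<^sub>R a) + (s / (s + t)) *\<^sub>R (x + t *\<^sub>R b) \<in> K"
    using s t w by (intro convexD[OF K]) auto
  also have "(t / (s + t)) *\<^sub>R (x + s *\<^sub>R a) + (s / (s + t)) *\<^sub>R (x + t *\<^sub>R b)
      = (t / (s + t) + s / (s + t)) *\<^sub>R x + r *\<^sub>R (a + b)"
    by (simp add: r_def algebra_simps)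
  finally have "x + r *\<^sub>R (a + b) \<in> K" by (simp add: w)
  moreover have "0 < r" using s t by (simp add: r_def)
  ultimately show ?thesis by (auto simp: feasible_directions_def)
qed

lemma feasible_directions_scale:
  assumes "x \<in> K" and "0 \<le> c" and a: "a \<in> feasible_directions K x"
  shows "c *\<^sub>R a \<in> feasible_directions K x"
proof (cases "c = 0")
  case True
  then show ?thesis using \<open>x \<in> K\<close> by (auto simp: feasible_directions_def intro: exI[of _ 1])
next
  case False
  obtain t where "0 < t" "x + t *\<^sub>R a \<in> K" using a by (auto simp: feasible_directions_def)
  then show ?thesis using False \<open>0 \<le> c\<close> unfolding feasible_directions_def
    by (intro CollectI exI[of _ "t / c"]) auto
qed

lemma subspace_two_sided_directions:
  assumes K: "convex K" and x: "x \<in> K"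
  shows "subspace (two_sided_directions K x)"
proof (rule subspaceI)
  have z: "0 \<in> feasible_directions K x"
    using x by (auto simp: feasible_directions_def intro: exI[of _ 1])
  then show "0 \<in> two_sided_directions K x" by (simp add: two_sided_directions_def)
  show "a + b \<in> two_sided_directions K x"
    if "a \<in> two_sided_directions K x" "b \<in> two_sided_directions K x" for a b
    using that feasible_directions_add[OF K, of a x b] feasible_directions_add[OF K, of "- a" x "- b"]
    by (simp add: two_sided_directions_def)
  show "c *\<^sub>R a \<in> two_sided_directions K x" if "a \<in> two_sided_directions K x" for c a
    using that feasible_directions_scale[OF x, of "\<bar>c\<bar>" a] feasible_directions_scale[OF x, of "\<bar>c\<bar>" "- a"]
    by (cases "0 \<le> c") (auto simp: two_sided_directions_def)
qed

text \<open>
  If \<open>x + s *\<^sub>R d\<close> and \<open>x - t *\<^sub>R d\<close> lie in \<open>K\<close>, then \<open>x\<close> is inside the segment between them, so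
  the face contains them and \<open>d\<close> is parallel to it.
\<close>

lemma dim_two_sided_directions_le_face:
  fixes K :: "'a::euclidean_space set"
  assumes K: "convex K" and F: "F face_of K" and x: "x \<in> F"
  shows "int (dim (two_sided_directions K x)) \<le> aff_dim F"
proof -
  have "d \<in> span ((\<lambda>y. y - x) ` F)" if d: "d \<in> two_sided_directions K x" for d
  proof (cases "d = 0")
    case False
    obtain s t where s: "0 < s" "x + s *\<^sub>R d \<in> K" and t: "0 < t" "x + t *\<^sub>R (- d) \<in> K"
      using d by (auto simp: two_sided_directions_def feasible_directions_def)
    have st: "0 < s + t" using s t by linarith
    have "x = (1 - t / (s + t)) *\<^sub>R (x + t *\<^sub>R (- d)) + (t / (s + t)) *\<^sub>R (x + s *\<^sub>R d)"
    proof -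
      have "(1 - t / (s + t)) *\<^sub>R (x + t *\<^sub>R (- d)) + (t / (s + t)) *\<^sub>R (x + s *\<^sub>R d)
          = x + (t / (s + t) * s - (1 - t / (s + t)) * t) *\<^sub>R d"
        by (simp add: algebra_simps)
      also have "t / (s + t) * s - (1 - t / (s + t)) * t = 0"
        using st by (simp add: field_simps)
      finally show ?thesis by simp
    qed
    moreover have "x + t *\<^sub>R (- d) \<noteq> x + s *\<^sub>R d"
    proof
      assume "x + t *\<^sub>R (- d) = x + s *\<^sub>R d"
      then have "(s + t) *\<^sub>R d = 0" by (simp add: algebra_simps)
      then show False using st False by simp
    qed
    moreover have "0 < t / (s + t)" "t / (s + t) < 1" using s t by auto
    ultimately have "x \<in> open_segment (x + t *\<^sub>R (- d)) (x + s *\<^sub>R d)"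
      unfolding in_segment by blast
    from face_ofD[OF F this t(2) s(2) x] have "x + s *\<^sub>R d \<in> F" ..
    then have "s *\<^sub>R d \<in> (\<lambda>y. y - x) ` F" by (auto simp: image_iff intro!: bexI[of _ "x + s *\<^sub>R d"])
    then have "inverse s *\<^sub>R s *\<^sub>R d \<in> span ((\<lambda>y. y - x) ` F)" by (intro span_scale span_base)
    then show ?thesis using s by simp
  qed (simp add: span_zero)
  then have "dim (two_sided_directions K x) \<le> dim ((\<lambda>y. y - x) ` F)"
    by (metis dim_span dim_subset subsetI)
  also have "int (dim ((\<lambda>y. y - x) ` F)) = aff_dim F"
    using aff_dim_eq_dim_subtract[of x F] x by (simp add: hull_inc)
  finally show ?thesis by simp
qed

section \<open>Symmetric directions on a plane of eigenvectors\<close>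

lemma outer_scale_left: "outer (c *\<^sub>R u) w = c *\<^sub>R outer u w"
  and outer_scale_right: "outer u (c *\<^sub>R w) = c *\<^sub>R outer u w"
  by (simp_all add: vec_eq_iff outer_def algebra_simps)

text \<open>
  The vectors \<open>q a\<close> and \<open>q b\<close> are turned by 45 degrees in their plane, up to the sign of the second
  one, which is immaterial because vectors enter a spectral matrix only through \<open>outer u u\<close>.
\<close>

definition rotate_pair :: "'n \<Rightarrow> 'n \<Rightarrow> ('n \<Rightarrow> real ^ 'n) \<Rightarrow> 'n \<Rightarrow> real ^ 'n" where
  "rotate_pair a b q = q(a := (1 / sqrt 2) *\<^sub>R (q a + q b), b := (1 / sqrt 2) *\<^sub>R (q a - q b))"

lemma orthonormal_rotate_pair:
  assumes q: "orthonormal q" and ab: "a \<noteq> b"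
  shows "orthonormal (rotate_pair a b q)"
  using ab unfolding orthonormal_def rotate_pair_def
  by (auto simp: orthonormal_inner[OF q] algebra_simps)

lemma spectral_matrix_rotate_pair:
  fixes q :: "'n::finite \<Rightarrow> real ^ 'n"
  assumes ab: "a \<noteq> b"
  shows "spectral_matrix (rotate_pair a b q) v = spectral_matrix q v
    + ((v $ a - v $ b) / 2) *\<^sub>R (outer (q a) (q b) + outer (q b) (q a))
    - ((v $ a - v $ b) / 2) *\<^sub>R (outer (q a) (q a) - outer (q b) (q b))"
proof -
  let ?R = "rotate_pair a b q" and ?rest = "UNIV - {a, b}"
  have split: "spectral_matrix p v = (\<Sum>i\<in>?rest. v $ i *\<^sub>R outer (p i) (p i))
      + (v $ a *\<^sub>R outer (p a) (p a) + v $ b *\<^sub>R outer (p b) (p b))" for p :: "'n \<Rightarrow> real ^ 'n"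
    unfolding spectral_matrix_def
    by (subst sum.subset_diff[of "{a, b}"]) (use ab in auto)
  have rest: "(\<Sum>i\<in>?rest. v $ i *\<^sub>R outer (?R i) (?R i)) = (\<Sum>i\<in>?rest. v $ i *\<^sub>R outer (q i) (q i))"
    by (rule sum.cong) (auto simp: rotate_pair_def)
  have h: "outer ((1 / sqrt 2) *\<^sub>R u) ((1 / sqrt 2) *\<^sub>R u) = (1/2) *\<^sub>R outer u u" for u :: "real ^ 'n"
    by (simp add: outer_scale_left outer_scale_right)
  have Ra: "outer (?R a) (?R a) = (1/2) *\<^sub>R outer (q a + q b) (q a + q b)"
    and Rb: "outer (?R b) (?R b) = (1/2) *\<^sub>R outer (q a - q b) (q a - q b)"
    using ab by (simp_all only: rotate_pair_def fun_upd_def h) (simp_all add: h)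
  have "v $ a *\<^sub>R outer (?R a) (?R a) + v $ b *\<^sub>R outer (?R b) (?R b) =
     v $ a *\<^sub>R outer (q a) (q a) + v $ b *\<^sub>R outer (q b) (q b)
    + ((v $ a - v $ b) / 2) *\<^sub>R (outer (q a) (q b) + outer (q b) (q a))
    - ((v $ a - v $ b) / 2) *\<^sub>R (outer (q a) (q a) - outer (q b) (q b))"
    unfolding Ra Rb
    by (simp add: vec_eq_iff outer_def field_simps)
  then show ?thesis unfolding split rest by simp
qed

lemma spectral_matrix_axis_diff:
  fixes q :: "'n::finite \<Rightarrow> real ^ 'n"
  shows "spectral_matrix q (v + t *\<^sub>R (axis a 1 - axis b 1)) =
    spectral_matrix q v + t *\<^sub>R (outer (q a) (q a) - outer (q b) (q b))"
proof -
  have 1: "spectral_matrix q (axis c 1) = outer (q c) (q c)" for c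
  proof -
    have "axis c 1 $ i *\<^sub>R outer (q i) (q i) = (if i = c then outer (q c) (q c) else 0)" for i
      by (simp add: axis_def)
    then show ?thesis by (simp add: spectral_matrix_def)
  qed
  show ?thesis
    by (simp only: linear_add[OF linear_spectral_matrix] linear_diff[OF linear_spectral_matrix]
        linear_cmul[OF linear_spectral_matrix] 1)
qed

text \<open>
  Let \<open>D\<close> be the diagonal and \<open>Q\<close> the off-diagonal direction. Spreading the two eigenvalues in the
  basis \<open>q\<close> gives \<open>D\<close> and \<open>- D\<close>. For \<open>Q\<close>, the spectrum is used in the rotated basis: eigenvalues
  with difference \<open>2 * c\<close> and unchanged sum yield the point of the hull at offset
  \<open>c *\<^sub>R Q - g *\<^sub>R D\<close> from \<open>spectral_matrix q v\<close>, where \<open>2 * g\<close> is the original difference. Since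
  \<open>D\<close> and \<open>- D\<close> are feasible, \<open>c *\<^sub>R Q\<close> is feasible too, and swapping the two eigenvalues gives the
  value \<open>- c\<close>. When the eigenvalues coincide, the spectrum \<open>v\<close> itself has \<open>c = 0\<close>; the small
  extra spread ensures \<open>c = h \<noteq> 0\<close>.
\<close>

lemma two_sided_block_directions:
  fixes f :: "real ^ 'n \<Rightarrow> real" and q :: "'n \<Rightarrow> real ^ 'n"
  assumes f: "symmetric_fun f" and q: "orthonormal q" and ab: "a \<noteq> b"
    and v: "v \<in> convex hull (sparse_spectra f k)"
    and spread_a: "\<exists>t>0. v + t *\<^sub>R (axis a 1 - axis b 1) \<in> convex hull (sparse_spectra f k)"
    and spread_b: "\<exists>t>0. v + t *\<^sub>R (axis b 1 - axis a 1) \<in> convex hull (sparse_spectra f k)"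
  defines "V \<equiv> two_sided_directions (convex hull (rank_spectral_set f k)) (spectral_matrix q v)"
  shows "outer (q a) (q a) - outer (q b) (q b) \<in> V"
    and "outer (q a) (q b) + outer (q b) (q a) \<in> V"
proof -
  let ?C = "convex hull (sparse_spectra f k)" and ?K = "convex hull (rank_spectral_set f k)"
  let ?X = "spectral_matrix q v"
  let ?W = "feasible_directions ?K ?X"
  let ?D = "outer (q a) (q a) - outer (q b) (q b)"
  let ?Q = "outer (q a) (q b) + outer (q b) (q a)"
  have XK: "?X \<in> ?K" using v by (simp add: spectral_matrix_in_hull_iff[OF f q])
  have D: "?D \<in> ?W"
    using spread_a unfolding feasible_directions_def
    by (simp flip: spectral_matrix_axis_diff add: spectral_matrix_in_hull_iff[OF f q])
  have mD: "- ?D \<in> ?W"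
    using spread_b unfolding feasible_directions_def minus_diff_eq
    by (simp flip: spectral_matrix_axis_diff add: spectral_matrix_in_hull_iff[OF f q])
  show "?D \<in> V" using D mD by (simp add: V_def two_sided_directions_def)
  let ?g = "(v $ a - v $ b) / 2"
  have gD: "c *\<^sub>R ?D \<in> ?W" for c
  proof (cases "0 \<le> c")
    case True
    then show ?thesis by (rule feasible_directions_scale[OF XK _ D])
  next
    case False
    then have "(- c) *\<^sub>R (- ?D) \<in> ?W" by (intro feasible_directions_scale[OF XK _ mD]) simp
    then show ?thesis by (simp only: scaleR_minus_left scaleR_minus_right minus_minus)
  qed
  obtain h where h: "h \<noteq> 0" "v + (h - ?g) *\<^sub>R (axis a 1 - axis b 1) \<in> ?C"
  proof (cases "0 \<le> ?g")
    case True
    from spread_a obtain t where t: "0 < t" "v + t *\<^sub>R (axis a 1 - axis b 1) \<in> ?C" by blast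
    have "?g + t \<noteq> 0" using True t(1) by linarith
    then show ?thesis using t(2) that[of "?g + t"] by simp
  next
    case False
    from spread_b obtain t where t: "0 < t" "v + t *\<^sub>R (axis b 1 - axis a 1) \<in> ?C" by blast
    have "v + (- t) *\<^sub>R (axis a 1 - axis b 1) \<in> ?C" using t(2) by (simp add: scaleR_diff_right)
    moreover have "?g - t \<noteq> 0" using False t(1) by linarith
    ultimately show ?thesis using that[of "?g - t"] by simp
  qed
  let ?w = "v + (h - ?g) *\<^sub>R (axis a 1 - axis b 1)"
  let ?w' = "?w - (?w $ a - ?w $ b) *\<^sub>R (axis a 1 - axis b 1)"
  have wab: "?w $ a - ?w $ b = 2 * h" using ab by (simp add: axis_def field_simps)
  have w': "?w' = v + (- h - ?g) *\<^sub>R (axis a 1 - axis b 1)"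
  proof -
    have "h - ?g - 2 * h = - h - ?g" by simp
    then show ?thesis unfolding wab by (metis add_diff_eq scaleR_diff_left)
  qed
  have w'C: "?w' \<in> ?C" by (rule swap_in_hull_sparse_spectra[OF f h(2)])
  have rot: "c *\<^sub>R ?Q - ?g *\<^sub>R ?D \<in> ?W"
    if "v + (c - ?g) *\<^sub>R (axis a 1 - axis b 1) \<in> ?C" for c
  proof -
    let ?u = "v + (c - ?g) *\<^sub>R (axis a 1 - axis b 1)"
    have uab: "(?u $ a - ?u $ b) / 2 = c" using ab by (simp add: axis_def field_simps)
    have "spectral_matrix (rotate_pair a b q) ?u = ?X + (c - ?g) *\<^sub>R ?D + c *\<^sub>R ?Q - c *\<^sub>R ?D"
      unfolding spectral_matrix_rotate_pair[OF ab, of q ?u] uab spectral_matrix_axis_diff[of q] ..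
    also have "\<dots> = ?X + 1 *\<^sub>R (c *\<^sub>R ?Q - ?g *\<^sub>R ?D)"
      by (simp add: scaleR_diff_left)
    finally have "?X + 1 *\<^sub>R (c *\<^sub>R ?Q - ?g *\<^sub>R ?D) \<in> ?K"
      using that spectral_matrix_in_hull_iff[OF f orthonormal_rotate_pair[OF q ab], of ?u] by metis
    then show ?thesis unfolding feasible_directions_def using zero_less_one by blast
  qed
  have off: "c *\<^sub>R ?Q \<in> ?W" if "v + (c - ?g) *\<^sub>R (axis a 1 - axis b 1) \<in> ?C" for c
    using feasible_directions_add[OF convex_convex_hull rot[OF that] gD[of ?g]] by simp
  have 1: "h *\<^sub>R ?Q \<in> ?W" by (rule off[OF h(2)])
  have 2: "(- h) *\<^sub>R ?Q \<in> ?W" using w'C unfolding w' by (rule off)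
  have pos: "\<bar>h\<bar> *\<^sub>R ?Q \<in> ?W" and neg: "(- \<bar>h\<bar>) *\<^sub>R ?Q \<in> ?W"
    using 1 2 by (cases "0 \<le> h"; simp)+
  have "inverse \<bar>h\<bar> *\<^sub>R (\<bar>h\<bar> *\<^sub>R ?Q) \<in> ?W" "inverse \<bar>h\<bar> *\<^sub>R ((- \<bar>h\<bar>) *\<^sub>R ?Q) \<in> ?W"
    by (rule feasible_directions_scale[OF XK _ pos], simp) (rule feasible_directions_scale[OF XK _ neg], simp)
  then show "?Q \<in> V" using h(1) by (simp add: V_def two_sided_directions_def)
qed

section \<open>The rank bound\<close>

lemma exists_least_subset:
  fixes g :: "'a \<Rightarrow> real"
  assumes "finite P" and "m \<le> card P"
  shows "\<exists>U\<subseteq>P. card U = m \<and> (\<forall>a\<in>U. \<forall>c\<in>P - U. g a \<le> g c)"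
  using assms(2)
proof (induction m)
  case 0
  show ?case by (intro exI[of _ "{}"]) simp
next
  case (Suc m)
  then obtain U where U: "U \<subseteq> P" "card U = m" "\<forall>a\<in>U. \<forall>c\<in>P - U. g a \<le> g c" by auto
  have finU: "finite U" using U assms(1) finite_subset by blast
  have ne: "P - U \<noteq> {}" using U Suc.prems card_mono[OF finU, of P] by auto
  define z where "z = arg_min_on g (P - U)"
  have z: "z \<in> P - U" "\<And>c. c \<in> P - U \<Longrightarrow> g z \<le> g c"
    using arg_min_if_finite(1)[of "P - U" g] arg_min_least[of "P - U" _ g] ne assms(1)
    by (auto simp: z_def)
  show ?case
    using U z finU by (intro exI[of _ "insert z U"]) auto
qed

text \<open>
  The symmetrised products of pairs with \<open>i \<le> j\<close> are nonzero and pairwise orthogonal.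
\<close>

lemma triangular_le_dim_block:
  fixes u :: "nat \<Rightarrow> real ^ 'n"
  assumes u: "\<And>i j. i < m \<Longrightarrow> j < m \<Longrightarrow> u i \<bullet> u j = (if i = j then 1 else 0)"
    and V: "\<And>i j. i < m \<Longrightarrow> j < m \<Longrightarrow> outer (u i) (u j) + outer (u j) (u i) \<in> span S"
  shows "m * (m + 1) \<le> 2 * dim S"
proof -
  define I where "I = (SIGMA j:{..<m}. {..j})"
  define G where "G = (\<lambda>(j, i). outer (u i) (u j) + outer (u j) (u i))"
  have finI: "finite I" by (simp add: I_def)
  have G: "G p \<bullet> G r = 0 \<longleftrightarrow> p \<noteq> r" if "p \<in> I" "r \<in> I" for p r
    using that by (auto simp: I_def G_def inner_add_left inner_add_right inner_outer u split: if_splits)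
  have inj: "inj_on G I"
    by (rule inj_onI) (metis G)
  have "independent (G ` I)"
  proof (rule pairwise_orthogonal_independent)
    show "pairwise orthogonal (G ` I)" by (auto simp: pairwise_def orthogonal_def G)
    show "0 \<notin> G ` I" using G by fastforce
  qed
  moreover have "G ` I \<subseteq> span S" using V by (auto simp: G_def I_def)
  ultimately have "card (G ` I) \<le> dim S"
    by (metis dim_eq_card_independent dim_span dim_subset)
  moreover have "2 * card I = m * (m + 1)"
  proof -
    have "2 * (\<Sum>j<m. Suc j) = m * (m + 1)" by (induction m) auto
    then show ?thesis by (simp add: I_def)
  qed
  ultimately show ?thesis by (simp add: card_image[OF inj])
qed

text \<open>
  Let \<open>U\<close> index the \<open>s + 1\<close> smallest positive eigenvalues of \<open>X\<close>, so that \<open>k - 1\<close> positive ones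
  remain. Any two indices of \<open>U\<close> together with the remaining ones are \<open>k + 1\<close>, more than the sparsity
  bound, so any two eigenvalues in \<open>U\<close> can be spread. Hence every traceless symmetric matrix on
  the span of the eigenvectors in \<open>U\<close> is a two-sided feasible direction at \<open>X\<close>. Adding the single
  matrix \<open>E\<close> to these gives all symmetric matrices on that span, so the dimension of the face is at
  least \<open>(s + 1) * (s + 2) div 2 - 1\<close>.
\<close>

theorem rank_excess_le_face_dim:
  fixes f :: "real ^ 'n \<Rightarrow> real"
  assumes f: "symmetric_fun f" and k: "1 \<le> k"
    and F: "F face_of (convex hull (rank_spectral_set f k))" and d: "aff_dim F = int d"
    and X: "X \<in> F" and s: "rank X = k + s"
  shows "s * (s + 3) \<le> 2 * d"
proof (cases "s = 0")
  case False
  let ?C = "convex hull (sparse_spectra f k)" and ?K = "convex hull (rank_spectral_set f k)"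
  have XK: "X \<in> ?K" using F X face_of_imp_subset by blast
  have "?K \<subseteq> {X. Finite_Cartesian_Product.transpose X = X}"
  proof (rule hull_minimal)
    show "rank_spectral_set f k \<subseteq> {X. Finite_Cartesian_Product.transpose X = X}" by (auto simp: rank_spectral_set_def psd_def)
    show "convex {X::real^'n^'n. Finite_Cartesian_Product.transpose X = X}"
      by (auto simp: convex_def vec_eq_iff Finite_Cartesian_Product.transpose_def)
  qed
  then obtain q v where q: "orthonormal q" and Xv: "X = spectral_matrix q v"
    using XK spectral_theorem[of X] by blast
  have vC: "v \<in> ?C" using XK spectral_matrix_in_hull_iff[OF f q] by (simp add: Xv)
  have nonneg: "0 \<le> v $ i" for i
  proof -
    have "?C \<subseteq> {v. 0 \<le> v $ i}"
      by (rule hull_minimal) (auto simp: sparse_spectra_def convex_def)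
    then show ?thesis using vC by blast
  qed
  define P where "P = {i. v $ i \<noteq> 0}"
  have P: "finite P" "card P = k + s" using s rank_spectral_matrix[OF q, of v] by (simp_all add: P_def Xv)
  obtain U where U: "U \<subseteq> P" "card U = Suc s" and least: "\<And>a c. a \<in> U \<Longrightarrow> c \<in> P - U \<Longrightarrow> v $ a \<le> v $ c"
    using exists_least_subset[OF P(1), of "Suc s" "\<lambda>i. v $ i"] P(2) k by auto
  have spread: "\<exists>t>0. v + t *\<^sub>R (axis a 1 - axis b 1) \<in> ?C"
    if ab: "a \<in> U" "b \<in> U" "a \<noteq> b" for a b
  proof (rule spread_two_small_entries[OF f vC _ _ \<open>a \<noteq> b\<close>])
    have "card (P - U) = k - 1" using U P by (simp add: card_Diff_subset finite_subset)
    then show "k < card (insert b (insert a (P - U)))" using ab P(1) k by simp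
    have "v $ b \<noteq> 0" using U ab by (auto simp: P_def)
    then show "0 < v $ b" using nonneg[of b] by simp
  qed (use least ab in auto)
  define V where "V = two_sided_directions ?K X"
  have V: "subspace V" unfolding V_def by (rule subspace_two_sided_directions[OF convex_convex_hull XK])
  have off: "outer (q a) (q b) + outer (q b) (q a) \<in> V" if "a \<in> U" "b \<in> U" "a \<noteq> b" for a b
    unfolding V_def Xv
    by (rule two_sided_block_directions(2)[OF f q \<open>a \<noteq> b\<close> vC spread spread]) (use that in auto)
  have diff: "outer (q a) (q a) - outer (q b) (q b) \<in> V" if "a \<in> U" "b \<in> U" for a b
  proof (cases "a = b")
    case True
    then show ?thesis using subspace_0[OF V] by simp
  next
    case False
    show ?thesis unfolding V_def Xv
      by (rule two_sided_block_directions(1)[OF f q False vC spread spread]) (use that False in auto)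
  qed
  obtain e where e: "bij_betw e {..<Suc s} U"
    using ex_bij_betw_nat_finite[of U] U P finite_subset by (metis atLeast0LessThan)
  have eU: "e i \<in> U" if "i < Suc s" for i using e that by (auto simp: bij_betw_def)
  define E where "E = outer (q (e 0)) (q (e 0))"
  have "Suc s * (Suc s + 1) \<le> 2 * dim (insert E V)"
  proof (rule triangular_le_dim_block)
    fix i j assume ij: "i < Suc s" "j < Suc s"
    show "q (e i) \<bullet> q (e j) = (if i = j then 1 else 0)"
      using e ij by (auto simp: orthonormal_inner[OF q] bij_betw_def inj_on_def)
    show "outer (q (e i)) (q (e j)) + outer (q (e j)) (q (e i)) \<in> span (insert E V)"
    proof (cases "e i = e j")
      case False
      then show ?thesis using off[OF eU[OF ij(1)] eU[OF ij(2)]] by (simp add: span_base)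
    next
      case True
      let ?D = "outer (q (e i)) (q (e i)) - E"
      have "?D \<in> span (insert E V)" "E \<in> span (insert E V)"
        using diff[OF eU eU, of i 0] ij by (simp_all add: E_def span_base)
      then have "(?D + E) + (?D + E) \<in> span (insert E V)" by (intro span_add)
      then show ?thesis using True by simp
    qed
  qed
  moreover have "dim (insert E V) \<le> dim V + 1" by (simp add: dim_insert)
  moreover have "dim V \<le> d"
    using dim_two_sided_directions_le_face[OF convex_convex_hull F X] d by (simp add: V_def)
  ultimately have "Suc s * (Suc s + 1) \<le> 2 * dim (insert E V)" "dim (insert E V) \<le> d + 1"
    by linarith+
  then have "Suc s * (Suc s + 1) \<le> 2 * (d + 1)" by (meson mult_le_mono2 order_trans)
  then show ?thesis by (simp add: algebra_simps)
qed simp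

lemma strengthened_rank_properties:
  assumes "1 \<le> k"
  shows "1 \<le> strengthened_rank f k"
    and "convex hull (rank_spectral_set f k) = convex hull (rank_spectral_set f (strengthened_rank f k))"
  using LeastI[of "\<lambda>j. 1 \<le> j \<and> j \<le> k \<and>
      convex hull (rank_spectral_set f k) = convex hull (rank_spectral_set f j)" k] assms
  unfolding strengthened_rank_def by blast+

lemma le_floor_root:
  assumes "s * (s + 3) \<le> 2 * d"
  shows "int s \<le> \<lfloor>sqrt (2 * real d + 9 / 4) - 3 / 2\<rfloor>"
proof -
  have "real (s * (s + 3)) \<le> real (2 * d)" using assms by (rule of_nat_mono)
  then have "(real s + 3 / 2)\<^sup>2 \<le> 2 * real d + 9 / 4"
    by (simp add: power2_eq_square algebra_simps)
  then have "real s + 3 / 2 \<le> sqrt (2 * real d + 9 / 4)" by (rule real_le_rsqrt)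
  then show ?thesis by (simp add: le_floor_iff)
qed

theorem theorem1:
  fixes f :: "real ^ 'n \<Rightarrow> real"
    and F :: "(real ^ 'n ^ 'n) set"
    and k d :: nat
  assumes "1 \<le> k" and "k \<le> CARD('n)"
    and "continuous_on UNIV f" and "convex_on UNIV f" and "symmetric_fun f"
    and "F face_of (convex hull (rank_spectral_set f k))"
    and "aff_dim F = int d"
  shows "\<forall>X\<in>F. int (rank X) \<le>
           int (strengthened_rank f k) + \<lfloor>sqrt (2 * real d + 9 / 4) - 3 / 2\<rfloor>"
proof
  fix X assume X: "X \<in> F"
  let ?k = "strengthened_rank f k" and ?s = "rank X - strengthened_rank f k"
  note k = strengthened_rank_properties[OF assms(1), of f]
  \<comment> \<open>For a rank below the strengthened rank the truncated difference is 0, and the bound at excess 0 suffices.\<close>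
  have "?s * (?s + 3) \<le> 2 * d"
  proof (cases "?k \<le> rank X")
    case True
    then show ?thesis
      using rank_excess_le_face_dim[OF assms(5) k(1) assms(6)[unfolded k(2)] assms(7) X, of ?s]
      by simp
  qed simp
  from le_floor_root[OF this]
  show "int (rank X) \<le> int ?k + \<lfloor>sqrt (2 * real d + 9 / 4) - 3 / 2\<rfloor>"
    by linarith
qed

end
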